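(* For each of the three representations $\mathcal{X}\in\{\mathcal{L},\mathcal{L}^M,\mathcal{W}\}$, the following decision problem is solvable in polynomial time. Input: a simple game $\Gamma$ on player set $N$, given by $N$ together with an explicit list of the coalitions in the family $\mathcal{X}$ of $\Gamma$ (all losing coalitions if $\mathcal{X}=\mathcal{L}$, all maximal losing coalitions if $\mathcal{X}=\mathcal{L}^M$, all winning coalitions if $\mathcal{X}=\mathcal{W}$), and two winning coalitions $S_1,S_2\in\mathcal{W}$ of $\Gamma$. Question: do there exist losing coalitions $S_3,S_4\in\mathcal{L}$ such that $(S_1,S_2,S_3,S_4)$ is a $2$-trade application of $\Gamma$?
   Context: A simple game $\Gamma$ is a pair $(N,\mathcal{W})$ where $N=\{1,\dots,n\}$ and $\mathcal{W}$ is a collection of subsets of $N$ such that (1) $N\in\mathcal{W}$, (2) $\emptyset\notin\mathcal{W}$, and (3) $S\in\mathcal{W}$ and $S\subseteq T\subseteq N$ imply $T\in\mathcal{W}$. Subsets of $N$ are called coalitions; those in $\mathcal{W}$ are winning, all others are losing, and $\mathcal{L}$ denotes the set of losing coalitions. $\mathcal{L}^M$ is the set of maximal losing coalitions (losing coalitions all of whose proper supersets are winning); it determines the game. A $j$-trade application of $\Gamma$ is a collection $(S_1,\dots,S_{2j})$ of $2j$ coalitions (repetitions allowed) for which there is $I\subseteq\{1,\dots,2j\}$ with $|I|=j$ such that for all $i\in\{1,\dots,2j\}$, $S_i\in\mathcal{W}\iff i\in I$, and for every $p\in N$, $|\{i\in I: p\in S_i\}|=|\{i\in\{1,\dots,2j\}\setminus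 I: p\in S_i\}|$. Running time is measured in the size of the input, i.e. of $N$, the explicit list of coalitions, and the given coalitions. *)

theory Defs
  imports "HOL-Computational_Algebra.Polynomial"
begin

section \<open>Simple games and trade applications\<close>

definition simple_game :: "nat set \<Rightarrow> nat set set \<Rightarrow> bool" where
  "simple_game N W \<longleftrightarrow>
     W \<subseteq> Pow N \<and> N \<in> W \<and> {} \<notin> W \<and>
     (\<forall>S T. S \<in> W \<and> S \<subseteq> T \<and> T \<subseteq> N \<longrightarrow> T \<in> W)"

definition winning_coalitions :: "nat set \<Rightarrow> nat set set \<Rightarrow> nat set set" where
  "winning_coalitions N W = W"

definition losing_coalitions :: "nat set \<Rightarrow> nat set set \<Rightarrow> nat set set" where
  "losing_coalitions N W = Pow N - W"

definition maximal_losing_coalitions :: "nat set \<Rightarrow> nat set set \<Rightarrow> nat set set" where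
  "maximal_losing_coalitions N W =
     {S \<in> losing_coalitions N W. \<forall>T. S \<subset> T \<and> T \<subseteq> N \<longrightarrow> T \<in> W}"

text \<open>The \<open>2 * j\<close> coalitions are indexed from \<open>0\<close>, as usual for lists, instead of from \<open>1\<close>.\<close>

definition trade_application ::
  "nat set \<Rightarrow> nat set set \<Rightarrow> nat \<Rightarrow> nat set list \<Rightarrow> bool" where
  "trade_application N W j Ss \<longleftrightarrow>
     length Ss = 2 * j \<and> set Ss \<subseteq> Pow N \<and>
     (\<exists>I \<subseteq> {..<2 * j}. card I = j \<and>
        (\<forall>i<2 * j. Ss ! i \<in> W \<longleftrightarrow> i \<in> I) \<and>
        (\<forall>p\<in>N. card {i \<in> I. p \<in> Ss ! i} = card {i \<in> {..<2 * j} - I. p \<in> Ss ! i}))"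


section \<open>Deterministic multitape Turing machines\<close>

datatype move = Move_Left | Move_Stay | Move_Right

text \<open>
  States and tape symbols are initial segments of the natural numbers; symbol \<open>0\<close> is the
  blank and state \<open>0\<close> is the start state.  A transition maps the current state and the list
  of scanned symbols (one per tape) to the next state and, for every tape, the symbol to be
  written and the head movement.
\<close>

record turing_machine =
  num_tapes :: nat
  num_symbols :: nat
  num_states :: nat
  accept_state :: nat
  reject_state :: nat
  transition :: "nat \<Rightarrow> nat list \<Rightarrow> nat \<times> (nat \<times> move) list"

definition wf_turing_machine :: "turing_machine \<Rightarrow> bool" where
  "wf_turing_machine M \<longleftrightarrow>
     0 < num_tapes M \<and> 0 < num_symbols M \<and> 0 < num_states M \<and>
     accept_state M < num_states M \<and> reject_state M < num_states M \<and>
     accept_state M \<noteq> reject_state M \<and>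
     (\<forall>q ss q' acts.
        q < num_states M \<and> length ss = num_tapes M \<and> set ss \<subseteq> {..<num_symbols M} \<and>
        transition M q ss = (q', acts) \<longrightarrow>
          q' < num_states M \<and> length acts = num_tapes M \<and>
          fst ` set acts \<subseteq> {..<num_symbols M})"

text \<open>Tapes are infinite in both directions; a tape is given by its content and its head position.\<close>

type_synonym tape = "(int \<Rightarrow> nat) \<times> int"
type_synonym configuration = "nat \<times> tape list"

fun scanned :: "tape \<Rightarrow> nat" where
  "scanned (f, h) = f h"

fun head_offset :: "move \<Rightarrow> int" where
  "head_offset Move_Left = - 1"
| "head_offset Move_Stay = 0"
| "head_offset Move_Right = 1"

fun tape_action :: "nat \<times> move \<Rightarrow> tape \<Rightarrow> tape" where
  "tape_action (s, m) (f, h) = (f(h := s), h + head_offset m)"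

definition tm_step :: "turing_machine \<Rightarrow> configuration \<Rightarrow> configuration" where
  "tm_step M = (\<lambda>(q, ts).
     if q = accept_state M \<or> q = reject_state M then (q, ts)
     else let (q', acts) = transition M q (map scanned ts)
          in (q', map2 tape_action acts ts))"

definition word_tape :: "nat list \<Rightarrow> tape" where
  "word_tape w = (\<lambda>i. if 0 \<le> i \<and> i < int (length w) then w ! nat i else 0, 0)"

definition initial_configuration :: "turing_machine \<Rightarrow> nat list \<Rightarrow> configuration" where
  "initial_configuration M w =
     (0, word_tape w # replicate (num_tapes M - 1) (word_tape []))"

definition state_after :: "turing_machine \<Rightarrow> nat list \<Rightarrow> nat \<Rightarrow> nat" where
  "state_after M w t = fst ((tm_step M ^^ t) (initial_configuration M w))"

text \<open>
  A decision problem is a set \<open>D\<close> of instances, an encoding of instances as words, and the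
  question asked about an instance.  The machine is not constrained on words that do
  not encode an instance.
\<close>

definition solvable_in_polynomial_time ::
  "'a set \<Rightarrow> ('a \<Rightarrow> nat list) \<Rightarrow> ('a \<Rightarrow> bool) \<Rightarrow> bool" where
  "solvable_in_polynomial_time D enc Q \<longleftrightarrow>
     (\<exists>M (p :: nat poly). wf_turing_machine M \<and>
        (\<forall>x\<in>D. set (enc x) \<subseteq> {1..<num_symbols M} \<and>
           (\<exists>t \<le> poly p (length (enc x)).
              state_after M (enc x) t = (if Q x then accept_state M else reject_state M))))"


section \<open>Extending two winning coalitions to a 2-trade application\<close>

text \<open>
  An instance \<open>(n, W, Xs, S1, S2)\<close> consists of the game with players \<open>{1..n}\<close> and winning
  coalitions \<open>W\<close>, a listing \<open>Xs\<close> of the representing family \<open>X {1..n} W\<close>, and the two given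
  winning coalitions.  The encoding below depends on \<open>W\<close> only through \<open>Xs\<close>.
\<close>

type_synonym trade_instance =
  "nat \<times> nat set set \<times> nat set list \<times> nat set \<times> nat set"

definition trade_instances ::
  "(nat set \<Rightarrow> nat set set \<Rightarrow> nat set set) \<Rightarrow> trade_instance set" where
  "trade_instances X =
     {(n, W, Xs, S1, S2).
        simple_game {1..n} W \<and> distinct Xs \<and> set Xs = X {1..n} W \<and> S1 \<in> W \<and> S2 \<in> W}"

text \<open>
  A coalition is written as its characteristic vector, with \<open>1\<close> standing for the digit zero,
  \<open>2\<close> for the digit one and \<open>3\<close> for a separator.
\<close>

definition encode_coalition :: "nat \<Rightarrow> nat set \<Rightarrow> nat list" where
  "encode_coalition n S = map (\<lambda>p. if p \<in> S then 2 else 1) [1..<Suc n] @ [3]"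

definition encode_instance :: "trade_instance \<Rightarrow> nat list" where
  "encode_instance = (\<lambda>(n, W, Xs, S1, S2).
     concat (map (encode_coalition n) ({1..n} # S1 # S2 # Xs)))"

definition extends_to_2_trade :: "trade_instance \<Rightarrow> bool" where
  "extends_to_2_trade = (\<lambda>(n, W, Xs, S1, S2).
     \<exists>S3 \<in> losing_coalitions {1..n} W. \<exists>S4 \<in> losing_coalitions {1..n} W.
       trade_application {1..n} W 2 [S1, S2, S3, S4])"

end

theory Submission
  imports Defs
begin

text \<open>
  A pair \<open>S3, S4\<close> completes the trade iff \<open>S1 \<inter> S2 = S3 \<inter> S4\<close> and \<open>S1 \<union> S2 = S3 \<union> S4\<close>.  Given the (maximal)
  losing coalitions, such a pair exists iff two listed coalitions \<open>A, B\<close> satisfy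
  \<open>S1 \<inter> S2 \<subseteq> A \<inter> B\<close> and \<open>S1 \<union> S2 \<subseteq> A \<union> B\<close>.  Given the winning coalitions, every candidate pair is
  determined by two winning coalitions \<open>A \<supseteq> S1\<close> and \<open>B \<supseteq> S2\<close>, so that there are at most
  \<open>card W ^ 2\<close> candidates, each of which is compared with all \<open>C \<in> W\<close>.  In all cases the question
  has the form \<open>\<exists>A B. \<forall>C. R A B C\<close> over the listed coalitions, where \<open>R\<close> is decided by a finite
  automaton that reads the columns of the characteristic vectors of \<open>S1, S2, A, B, C\<close>.  A single
  Turing machine, parametrized by the automaton, searches through all triples.
\<close>

section \<open>Machines with a finite type of control states\<close>

text \<open>This is \<open>tm_step\<close> over an arbitrary type of states, so that a state can be
  a tuple; states are numbered only once, in
  \<open>solvable_in_polynomial_time_finite_control\<close>.\<close>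

definition control_step ::
  "'q \<Rightarrow> 'q \<Rightarrow> ('q \<Rightarrow> nat list \<Rightarrow> 'q \<times> (nat \<times> move) list) \<Rightarrow> 'q \<times> tape list \<Rightarrow> 'q \<times> tape list" where
  "control_step acc rej \<tau> = (\<lambda>(q, ts).
     if q = acc \<or> q = rej then (q, ts)
     else let (q', acts) = \<tau> q (map scanned ts) in (q', map2 tape_action acts ts))"

text \<open>Turing machines start in state \<open>0\<close>, so the numbering has to send the chosen
  start state there; the other states are numbered from 1.\<close>

lemma bij_betw_finite_type_at_zero:
  fixes q0 :: "'q::finite"
  obtains e where "bij_betw e (UNIV :: 'q set) {..<card (UNIV :: 'q set)}" "e q0 = (0::nat)"
proof -
  have "card (UNIV - {q0}) = card {1..<card (UNIV :: 'q set)}"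
    by (simp add: card_Diff_singleton)
  then obtain g where g: "bij_betw g (UNIV - {q0}) {1..<card (UNIV :: 'q set)}"
    using finite_same_card_bij[of "UNIV - {q0}" "{1..<card (UNIV :: 'q set)}"] by auto
  have "bij_betw (g(q0 := 0)) (UNIV - {q0} \<union> {q0}) ({1..<card (UNIV :: 'q set)} \<union> {0})"
  proof (rule bij_betw_combine)
    show "bij_betw (g(q0 := 0)) (UNIV - {q0}) {1..<card (UNIV :: 'q set)}"
      using g by (rule bij_betw_cong[THEN iffD1, rotated]) simp
  qed auto
  moreover have "{1..<card (UNIV :: 'q set)} \<union> {0} = {..<card (UNIV :: 'q set)}"
    using finite_UNIV_card_ge_0[where ?'a = 'q] by auto
  ultimately show ?thesis using that[of "g(q0 := 0)"] by simp
qed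

text \<open>Numbering the states by a bijection \<open>e\<close> gives a machine whose runs are the
  images of the given runs, so time bound and answer carry over.\<close>

lemma solvable_in_polynomial_time_finite_control:
  fixes \<tau> :: "'q::finite \<Rightarrow> nat list \<Rightarrow> 'q \<times> (nat \<times> move) list" and p :: "nat poly"
  assumes "0 < k" "0 < a" "acc \<noteq> rej"
    and wf: "\<And>q ss. length ss = k \<Longrightarrow> set ss \<subseteq> {..<a} \<Longrightarrow>
      length (snd (\<tau> q ss)) = k \<and> fst ` set (snd (\<tau> q ss)) \<subseteq> {..<a}"
    and enc: "\<And>x. x \<in> D \<Longrightarrow> set (enc x) \<subseteq> {1..<a}"
    and run: "\<And>x. x \<in> D \<Longrightarrow> \<exists>t \<le> poly p (length (enc x)).
      fst ((control_step acc rej \<tau> ^^ t) (q0, word_tape (enc x) # replicate (k - 1) (word_tape [])))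
        = (if Q x then acc else rej)"
  shows "solvable_in_polynomial_time D enc Q"
proof -
  obtain e where e: "bij_betw e (UNIV :: 'q set) {..<card (UNIV :: 'q set)}" and e0: "e q0 = (0::nat)"
    by (rule bij_betw_finite_type_at_zero)
  have inj: "e x = e y \<longleftrightarrow> x = y" for x y
    using e by (auto simp: bij_betw_def inj_on_def)
  have lt: "e x < card (UNIV :: 'q set)" for x
    using e by (auto simp: bij_betw_def)
  have inv_e: "inv e (e x) = x" for x
    using inj by (simp add: inv_f_eq inj_def)
  define M where "M = \<lparr>num_tapes = k, num_symbols = a, num_states = card (UNIV :: 'q set),
    accept_state = e acc, reject_state = e rej,
    transition = (\<lambda>q ss. apfst e (\<tau> (inv e q) ss))\<rparr>"
  have M: "wf_turing_machine M"
    unfolding wf_turing_machine_def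
  proof (intro conjI allI impI; (elim conjE)?)
    fix q ss q' acts
    assume "length ss = num_tapes M" "set ss \<subseteq> {..<num_symbols M}"
      and t: "transition M q ss = (q', acts)"
    hence ss: "length ss = k" "set ss \<subseteq> {..<a}" by (simp_all add: M_def)
    have q': "q' = e (fst (\<tau> (inv e q) ss))" and acts: "acts = snd (\<tau> (inv e q) ss)"
      using t by (cases "\<tau> (inv e q) ss"; auto simp: M_def)+
    show "q' < num_states M" using lt by (simp add: q' M_def)
    show "length acts = num_tapes M" "fst ` set acts \<subseteq> {..<num_symbols M}"
      using wf[OF ss] by (simp_all add: acts M_def)
  qed (use assms(1-3) lt inj in \<open>simp_all add: M_def finite_UNIV_card_ge_0\<close>)
  \<comment> \<open>Injectivity of \<open>e\<close> makes the two halting tests agree, and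
    \<open>inv e\<close> undoes the renaming before \<open>\<tau>\<close> is consulted.\<close>
  have step: "tm_step M (apfst e c) = apfst e (control_step acc rej \<tau> c)" for c
    by (cases c) (auto simp: tm_step_def control_step_def M_def inj inv_e split: prod.splits)
  have steps: "(tm_step M ^^ t) (apfst e c) = apfst e ((control_step acc rej \<tau> ^^ t) c)" for t c
    by (induction t) (simp_all add: step)
  have init: "initial_configuration M w
      = apfst e (q0, word_tape w # replicate (k - 1) (word_tape []))" for w
    by (simp add: initial_configuration_def M_def e0)
  show ?thesis
    unfolding solvable_in_polynomial_time_def
  proof (rule exI[of _ M], rule exI[of _ p], intro conjI ballI)
    fix x assume "x \<in> D"
    then obtain t where "t \<le> poly p (length (enc x))" and "fst ((control_step acc rej \<tau> ^^ t)
        (q0, word_tape (enc x) # replicate (k - 1) (word_tape []))) = (if Q x then acc else rej)"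
      using run by blast
    thus "\<exists>t\<le>poly p (length (enc x)).
        state_after M (enc x) t = (if Q x then accept_state M else reject_state M)"
      unfolding state_after_def init steps by (auto simp: M_def)
  next
    fix x assume "x \<in> D"
    thus "set (enc x) \<subseteq> {1..<num_symbols M}" using enc by (simp add: M_def)
  qed (rule M)
qed


section \<open>A machine running through all triples of listed coalitions\<close>

datatype phase = Skip | Copy1 | Copy2 | Copy_List | Scan | Next_C | Next_B | Next_A | Accept | Reject

instance phase :: finite
proof
  have "(UNIV :: phase set) =
      {Skip, Copy1, Copy2, Copy_List, Scan, Next_C, Next_B, Next_A, Accept, Reject}"
    using phase.exhaust by blast
  thus "finite (UNIV :: phase set)" by (metis finite.emptyI finite_insert)
qed

section \<open>Tape contents and characteristic vectors\<close>

definition content :: "nat list \<Rightarrow> int \<Rightarrow> nat" where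
  "content w = (\<lambda>i. if 0 \<le> i \<and> i < int (length w) then w ! nat i else 0)"

lemma word_tape_eq: "word_tape w = (content w, 0)"
  by (simp add: word_tape_def content_def)

lemma content_nth: "i < length w \<Longrightarrow> content w (int i) = w ! i"
  by (simp add: content_def)

lemma content_eq_0: "i < 0 \<or> int (length w) \<le> i \<Longrightarrow> content w i = 0"
  by (auto simp: content_def)

lemma content_middle: "content (us @ x # ys) (int (length us)) = x"
  by (simp add: content_def)

lemma content_snoc: "(content w)(int (length w) := x) = content (w @ [x])"
  by (auto simp: content_def fun_eq_iff nth_append)

lemma tape_action_stay: "tape_action (scanned T, Move_Stay) T = T"
  by (cases T) simp

text \<open>The argument \<open>p\<close> is a position in the word, so it stands for player \<open>p + 1\<close>.\<close>

definition symbol :: "nat \<Rightarrow> nat set \<Rightarrow> nat" where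
  "symbol p S = (if Suc p \<in> S then 2 else 1)"

lemma symbol_cases: "symbol p S \<noteq> 0" "symbol p S \<noteq> 3"
  by (simp_all add: symbol_def)

definition body :: "nat \<Rightarrow> nat set \<Rightarrow> nat list" where
  "body n S = map (\<lambda>p. if p \<in> S then 2 else 1) [1..<Suc n]"

lemma encode_coalition_eq: "encode_coalition n S = body n S @ [3]"
  by (simp add: encode_coalition_def body_def)

lemma body_symbols: "set (body n S) \<subseteq> {1, 2}"
  by (auto simp: body_def)

lemma length_body [simp]: "length (body n S) = n"
  by (simp add: body_def)

lemma length_encode_coalition [simp]: "length (encode_coalition n S) = Suc n"
  by (simp add: encode_coalition_eq)

lemma set_encode_coalition: "set (encode_coalition n S) \<subseteq> {1, 2, 3}"
  using body_symbols[of n S] by (auto simp: encode_coalition_eq)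

text \<open>
  Tape 0 holds the input; tapes 1 to 5 receive the vectors of \<open>S1\<close> and \<open>S2\<close> and three copies of the list,
  for \<open>A\<close>, \<open>B\<close> and \<open>C\<close>.  Afterwards nothing is overwritten.  Blocks are scanned from right to left,
  which leaves each list head at the end of the preceding block, or on a blank when the list is
  exhausted; tape 1 serves as the clock that measures one block.  \<open>Next_C\<close>, \<open>Next_B\<close>, \<open>Next_A\<close> then
  return all heads except the one that advances, as in an odometer.
\<close>

locale triple_machine =
  fixes \<delta> :: "'d::finite \<Rightarrow> nat list \<Rightarrow> 'd" and init :: 'd and F :: "'d \<Rightarrow> bool"
begin

text \<open>In a state, \<open>ok\<close> collects verdicts for the current \<open>A, B\<close>, and
  \<open>d\<close> is the automaton state within the current block. Symbols and moves are listed
  separately, so that returning \<open>ss\<close> leaves the contents unchanged. A blank on tape 1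
  ends a block; blanks on tapes 5, 4, 3 at that moment mean that \<open>C\<close>, \<open>B\<close>,
  \<open>A\<close> have run through the list.\<close>

definition trans ::
  "phase \<times> bool \<times> 'd \<Rightarrow> nat list \<Rightarrow> (phase \<times> bool \<times> 'd) \<times> nat list \<times> move list" where
  "trans = (\<lambda>(ph, ok, d) ss.
    case ph of
      Skip \<Rightarrow> ((if ss ! 0 = 3 then Copy1 else Skip, True, init), ss,
        [Move_Right, Move_Stay, Move_Stay, Move_Stay, Move_Stay, Move_Stay])
    | Copy1 \<Rightarrow> ((if ss ! 0 = 3 then Copy2 else Copy1, True, init), ss[1 := ss ! 0],
        [Move_Right, Move_Right, Move_Stay, Move_Stay, Move_Stay, Move_Stay])
    | Copy2 \<Rightarrow> ((if ss ! 0 = 3 then Copy_List else Copy2, True, init), ss[2 := ss ! 0],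
        [Move_Right, Move_Stay, Move_Right, Move_Stay, Move_Stay, Move_Stay])
    | Copy_List \<Rightarrow>
        if ss ! 0 \<noteq> 0
        then ((Copy_List, True, init), ss[3 := ss ! 0, 4 := ss ! 0, 5 := ss ! 0],
          [Move_Right, Move_Stay, Move_Stay, Move_Right, Move_Right, Move_Right])
        else ((Scan, True, init), ss,
          [Move_Stay, Move_Left, Move_Left, Move_Left, Move_Left, Move_Left])
    | Scan \<Rightarrow>
        if ss ! 1 \<noteq> 0
        then ((Scan, ok, if ss ! 1 = 3 then init else \<delta> d (tl ss)), ss,
          [Move_Stay, Move_Left, Move_Left, Move_Left, Move_Left, Move_Left])
        else (
          if ss ! 5 \<noteq> 0 then (Next_C, ok \<and> F d, init)
          else if ok \<and> F d then (Accept, True, init)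
          else if ss ! 4 \<noteq> 0 then (Next_B, True, init)
          else if ss ! 3 \<noteq> 0 then (Next_A, True, init)
          else (Reject, True, init), ss, replicate 6 Move_Stay)
    | Next_C \<Rightarrow>
        if ss ! 1 = 3 then ((Scan, ok, init), ss, replicate 6 Move_Stay)
        else ((Next_C, ok, init), ss,
          [Move_Stay, Move_Right, Move_Right, Move_Right, Move_Right, Move_Stay])
    | Next_B \<Rightarrow>
        if ss ! 1 \<noteq> 3 then ((Next_B, True, init), ss,
          [Move_Stay, Move_Right, Move_Right, Move_Right, Move_Stay, Move_Right])
        else if ss ! 5 \<noteq> 0 then ((Next_B, True, init), ss,
          [Move_Stay, Move_Stay, Move_Stay, Move_Stay, Move_Stay, Move_Right])
        else ((Scan, True, init), ss,
          [Move_Stay, Move_Stay, Move_Stay, Move_Stay, Move_Stay, Move_Left])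
    | Next_A \<Rightarrow>
        if ss ! 1 \<noteq> 3 then ((Next_A, True, init), ss,
          [Move_Stay, Move_Right, Move_Right, Move_Stay, Move_Right, Move_Right])
        else if ss ! 5 \<noteq> 0 then ((Next_A, True, init), ss,
          [Move_Stay, Move_Stay, Move_Stay, Move_Stay, Move_Right, Move_Right])
        else ((Scan, True, init), ss,
          [Move_Stay, Move_Stay, Move_Stay, Move_Stay, Move_Left, Move_Left])
    | _ \<Rightarrow> ((ph, ok, d), ss, replicate 6 Move_Stay))"

definition \<tau> where
  "\<tau> q ss = (case trans q ss of (q', ws, ms) \<Rightarrow> (q', zip ws ms))"

abbreviation "acc \<equiv> (Accept, True, init)"
abbreviation "rej \<equiv> (Reject, True, init)"
abbreviation "step \<equiv> control_step acc rej \<tau>"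

text \<open>The machine only copies symbols, hence every alphabet containing the scanned ones is
  closed under its steps.\<close>

lemma trans_lengths_and_symbols:
  assumes "trans q ss = (q', ws, ms)" "length ss = 6"
  shows "length ws = 6 \<and> length ms = 6 \<and> set ws \<subseteq> set ss"
proof -
  have upd: "set (xs[i := ss ! 0]) \<subseteq> set ss" if "set xs \<subseteq> set ss" for xs i
    using that assms(2) by (intro order.trans[OF set_update_subset_insert]) auto
  have "set (ss[1 := ss ! 0]) \<subseteq> set ss" "set (ss[2 := ss ! 0]) \<subseteq> set ss"
      "set (ss[3 := ss ! 0, 4 := ss ! 0, 5 := ss ! 0]) \<subseteq> set ss"
    by (intro upd order.refl)+
  moreover obtain ph ok d where "q = (ph, ok, d)" by (cases q)
  ultimately have "case trans q ss of (q', ws, ms) \<Rightarrow>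
      length ws = 6 \<and> length ms = 6 \<and> set ws \<subseteq> set ss"
    using assms(2) by (cases ph) (simp_all add: trans_def del: One_nat_def)
  thus ?thesis using assms(1) by simp
qed

lemma \<tau>_wf:
  assumes "length ss = 6" "set ss \<subseteq> {..<a}"
  shows "length (snd (\<tau> q ss)) = 6 \<and> fst ` set (snd (\<tau> q ss)) \<subseteq> {..<a}"
proof -
  obtain q' ws ms where t: "trans q ss = (q', ws, ms)" by (cases "trans q ss")
  have "fst ` set (zip ws ms) \<subseteq> set ws" by (auto dest: set_zip_leftD)
  thus ?thesis
    using trans_lengths_and_symbols[OF t assms(1)] assms(2) by (auto simp: \<tau>_def t)
qed

lemma step_eq:
  assumes "ph \<noteq> Accept" "ph \<noteq> Reject"
  shows "step ((ph, ok, d), ts) = (case trans (ph, ok, d) (map scanned ts) of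
    (q', ws, ms) \<Rightarrow> (q', map2 tape_action (zip ws ms) ts))"
  using assms by (auto simp: control_step_def \<tau>_def split: prod.splits)

section \<open>Setting up the six tapes\<close>

lemma skip_word:
  assumes "3 \<notin> set xs"
  shows "(step ^^ length xs) ((Skip, True, init),
      [(content (us @ xs @ ys), int (length us)), T1, T2, T3, T4, T5]) =
    ((Skip, True, init), [(content (us @ xs @ ys), int (length (us @ xs))), T1, T2, T3, T4, T5])"
  using assms
\<comment> \<open>Induction from the right, because the outermost \<open>step\<close> of a power is
  executed last; the letter split off joins the unread rest \<open>ys\<close>.\<close>
proof (induction xs arbitrary: ys rule: rev_induct)
  case (snoc x xs)
  have "content (us @ xs @ x # ys) (int (length us) + int (length xs)) = x"
    using content_middle[of "us @ xs" x ys] by simp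
  thus ?case using snoc.IH[of "x # ys"] snoc.prems
    by (simp add: step_eq trans_def tape_action_stay fun_upd_idem)
qed simp

lemma copy1_word:
  assumes "3 \<notin> set xs"
  shows "(step ^^ length xs) ((Copy1, True, init),
      [(content (us @ xs @ ys), int (length us)), (content vs, int (length vs)), T2, T3, T4, T5]) =
    ((Copy1, True, init), [(content (us @ xs @ ys), int (length (us @ xs))),
      (content (vs @ xs), int (length (vs @ xs))), T2, T3, T4, T5])"
  using assms
proof (induction xs arbitrary: ys rule: rev_induct)
  case (snoc x xs)
  have "content (us @ xs @ x # ys) (int (length us) + int (length xs)) = x"
    using content_middle[of "us @ xs" x ys] by simp
  thus ?case using snoc.IH[of "x # ys"] snoc.prems content_snoc[of "vs @ xs" x]
    by (simp add: step_eq trans_def tape_action_stay fun_upd_idem)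
qed simp

lemma copy2_word:
  assumes "3 \<notin> set xs"
  shows "(step ^^ length xs) ((Copy2, True, init),
      [(content (us @ xs @ ys), int (length us)), T1, (content vs, int (length vs)), T3, T4, T5]) =
    ((Copy2, True, init), [(content (us @ xs @ ys), int (length (us @ xs))), T1,
      (content (vs @ xs), int (length (vs @ xs))), T3, T4, T5])"
  using assms
proof (induction xs arbitrary: ys rule: rev_induct)
  case (snoc x xs)
  have "content (us @ xs @ x # ys) (int (length us) + int (length xs)) = x"
    using content_middle[of "us @ xs" x ys] by simp
  thus ?case using snoc.IH[of "x # ys"] snoc.prems content_snoc[of "vs @ xs" x]
    by (simp add: step_eq trans_def tape_action_stay fun_upd_idem)
qed simp

lemma copy_list_word:
  assumes "0 \<notin> set xs"
  shows "(step ^^ length xs) ((Copy_List, True, init),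
      [(content (us @ xs @ ys), int (length us)), T1, T2, (content vs, int (length vs)),
       (content vs, int (length vs)), (content vs, int (length vs))]) =
    ((Copy_List, True, init), [(content (us @ xs @ ys), int (length (us @ xs))), T1, T2,
      (content (vs @ xs), int (length (vs @ xs))), (content (vs @ xs), int (length (vs @ xs))),
      (content (vs @ xs), int (length (vs @ xs)))])"
  using assms
proof (induction xs arbitrary: ys rule: rev_induct)
  case (snoc x xs)
  have "content (us @ xs @ x # ys) (int (length us) + int (length xs)) = x"
    using content_middle[of "us @ xs" x ys] by simp
  thus ?case using snoc.IH[of "x # ys"] snoc.prems content_snoc[of "vs @ xs" x]
    by (simp add: step_eq trans_def tape_action_stay fun_upd_idem)
qed simp

end

text \<open>Fixes one instance. A nonempty list guarantees that the list heads find a block to scan;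
  each of the three representing families is nonempty.\<close>

locale triple_run = triple_machine \<delta> init F
  for \<delta> :: "'d::finite \<Rightarrow> nat list \<Rightarrow> 'd" and init F +
  fixes n :: nat and S1 S2 :: "nat set" and Xs :: "nat set list"
  assumes Xs_nonempty: "Xs \<noteq> []"
begin

abbreviation "m \<equiv> length Xs"
abbreviation "list_word \<equiv> concat (map (encode_coalition n) Xs)"
definition input :: "nat list" where
  "input = concat (map (encode_coalition n) ({1..n} # S1 # S2 # Xs))"

abbreviation "f1 \<equiv> content (encode_coalition n S1)"
abbreviation "f2 \<equiv> content (encode_coalition n S2)"
abbreviation "fX \<equiv> content list_word"

text \<open>After the setup tape 0 stays parked behind the input, and tapes 1 and 2 move in step, so
  that one position \<open>h\<close> serves both.\<close>

abbreviation conf where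
  "conf q h a b c \<equiv> (q, [(content input, int (length input)), (f1, h), (f2, h),
    (fX, a), (fX, b), (fX, c)])"

lemma length_list_word: "length list_word = m * Suc n"
  by (induction Xs) simp_all

lemma list_word_symbols: "set list_word \<subseteq> {1, 2, 3}"
  using set_encode_coalition by fastforce

text \<open>One step per input letter, plus one that meets the blank behind the input and moves the
  five working heads back onto the last separators.\<close>

lemma setup_run:
  "(step ^^ (length input + 1)) ((Skip, True, init), word_tape input # replicate 5 (word_tape [])) =
    conf (Scan, True, init) (int n)
      (int (m * Suc n) - 1) (int (m * Suc n) - 1) (int (m * Suc n) - 1)"
proof -
  define eN where "eN = body n {1..n}"
  define e1 where "e1 = body n S1"
  define e2 where "e2 = body n S2"
  define eX where "eX = list_word"
  define E where "E = content []"
  have no3: "3 \<notin> set eN" "3 \<notin> set e1" "3 \<notin> set e2"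
    by (auto simp: eN_def e1_def e2_def dest: subsetD[OF body_symbols])
  have no0: "0 \<notin> set eX" using list_word_symbols by (auto simp: eX_def)
  have input: "input = eN @ 3 # e1 @ 3 # e2 @ 3 # eX"
    by (simp add: input_def eN_def e1_def e2_def eX_def encode_coalition_eq)
  have len: "length eN = n" "length e1 = n" "length e2 = n" "length eX = m * Suc n"
    by (simp_all add: eN_def e1_def e2_def eX_def length_list_word)
  let ?w = "content input"
  have c: "?w (int n) = 3" "?w (2 * int n + 1) = 3" "?w (3 * int n + 2) = 3"
    using content_middle[of eN 3 "e1 @ 3 # e2 @ 3 # eX"]
      content_middle[of "eN @ 3 # e1" 3 "e2 @ 3 # eX"]
      content_middle[of "eN @ 3 # e1 @ 3 # e2" 3 eX]
    by (simp_all add: input len algebra_simps)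
  have r1: "(step ^^ n) ((Skip, True, init),
        [(?w, 0), (E, 0), (E, 0), (E, 0), (E, 0), (E, 0)]) =
      ((Skip, True, init),
        [(?w, int n), (E, 0), (E, 0), (E, 0), (E, 0), (E, 0)])"
    using skip_word[OF no3(1), of "[]" "3 # e1 @ 3 # e2 @ 3 # eX"] by (simp add: input len)
  have s1: "step ((Skip, True, init),
        [(?w, int n), (E, 0), (E, 0), (E, 0), (E, 0), (E, 0)]) =
      ((Copy1, True, init),
        [(?w, int n + 1), (E, 0), (E, 0), (E, 0), (E, 0), (E, 0)])"
    by (simp add: step_eq trans_def c fun_upd_idem)
  have r2: "(step ^^ n) ((Copy1, True, init),
        [(?w, int n + 1), (E, 0), (E, 0), (E, 0), (E, 0), (E, 0)]) =
      ((Copy1, True, init),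
        [(?w, 2 * int n + 1), (content e1, int n), (E, 0), (E, 0), (E, 0), (E, 0)])"
    using copy1_word[OF no3(2), of "eN @ [3]" "3 # e2 @ 3 # eX" "[]"]
    by (simp add: input len E_def algebra_simps)
  have s2: "step ((Copy1, True, init),
        [(?w, 2 * int n + 1), (content e1, int n), (E, 0), (E, 0), (E, 0), (E, 0)]) =
      ((Copy2, True, init),
        [(?w, 2 * int n + 2), (f1, int n + 1), (E, 0), (E, 0), (E, 0), (E, 0)])"
    using content_snoc[of e1 3]
    by (simp add: step_eq trans_def c fun_upd_idem len encode_coalition_eq e1_def)
  have r3: "(step ^^ n) ((Copy2, True, init),
        [(?w, 2 * int n + 2), (f1, int n + 1), (E, 0), (E, 0), (E, 0), (E, 0)]) =
      ((Copy2, True, init),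
        [(?w, 3 * int n + 2), (f1, int n + 1), (content e2, int n), (E, 0), (E, 0), (E, 0)])"
    using copy2_word[OF no3(3), of "eN @ 3 # e1 @ [3]" "3 # eX" _ "[]"]
    by (simp add: input len E_def algebra_simps)
  have s3: "step ((Copy2, True, init),
        [(?w, 3 * int n + 2), (f1, int n + 1), (content e2, int n), (E, 0), (E, 0), (E, 0)]) =
      ((Copy_List, True, init),
        [(?w, 3 * int n + 3), (f1, int n + 1), (f2, int n + 1), (E, 0), (E, 0), (E, 0)])"
    using content_snoc[of e2 3]
    by (simp add: step_eq trans_def c fun_upd_idem len encode_coalition_eq e2_def)
  have r4: "(step ^^ (m * Suc n)) ((Copy_List, True, init),
        [(?w, 3 * int n + 3), (f1, int n + 1), (f2, int n + 1), (E, 0), (E, 0), (E, 0)]) =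
      ((Copy_List, True, init),
        [(?w, int (length input)), (f1, int n + 1), (f2, int n + 1),
         (fX, int (m * Suc n)), (fX, int (m * Suc n)), (fX, int (m * Suc n))])"
    using copy_list_word[OF no0, of "eN @ 3 # e1 @ 3 # e2 @ [3]" "[]" _ _ "[]"]
    unfolding len by (simp add: input len E_def eX_def length_list_word algebra_simps)
  have s4: "step ((Copy_List, True, init),
        [(?w, int (length input)), (f1, int n + 1), (f2, int n + 1),
         (fX, int (m * Suc n)), (fX, int (m * Suc n)), (fX, int (m * Suc n))]) =
      conf (Scan, True, init) (int n)
        (int (m * Suc n) - 1) (int (m * Suc n) - 1) (int (m * Suc n) - 1)"
    by (simp add: step_eq trans_def content_eq_0 fun_upd_idem del: of_nat_mult)
  have start: "word_tape input # replicate 5 (word_tape []) =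
      [(?w, 0), (E, 0), (E, 0), (E, 0), (E, 0), (E, 0)]"
    by (simp add: word_tape_eq E_def numeral_eq_Suc)
  have t: "length input + 1 = Suc (m * Suc n + Suc (n + Suc (n + Suc n)))"
    by (simp add: input len)
  \<comment> \<open>The nesting in \<open>t\<close> alternates runs over a word with the single
    steps that change the phase, in the order of the phases.\<close>
  show ?thesis
    unfolding t start funpow.simps funpow_add o_apply r1 s1 r2 s2 r3 s3 r4 s4 ..
qed

text \<open>The head position at the separator that ends the \<open>r\<close>-th block, counted from 1; \<open>pos 0\<close> is the
  blank to the left of the tape content.\<close>

definition pos :: "nat \<Rightarrow> int" where
  "pos r = int (r * Suc n) - 1"

section \<open>Symbols found at block positions\<close>

lemma encode_coalition_nth: "p < n \<Longrightarrow> encode_coalition n S ! p = symbol p S"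
  by (simp add: encode_coalition_def symbol_def nth_append del: upt_Suc)

lemma content_coalition:
  "p < n \<Longrightarrow> content (encode_coalition n S) (int p) = symbol p S"
  by (simp add: content_nth encode_coalition_nth)

lemma content_coalition_ends:
  "content (encode_coalition n S) (pos 0) = 0" "content (encode_coalition n S) (pos (Suc 0)) = 3"
  using content_middle[of "body n S" 3 "[]"]
  by (simp_all add: pos_def content_eq_0 encode_coalition_eq)

text \<open>The return phases stop at the separator on tape 1; this keeps them from stopping before
  \<open>n + 1\<close> moves are done. Offset 0 is the blank left of the block, offset
  \<open>Suc p\<close> is letter \<open>p\<close>.\<close>

lemma content_coalition_before_end:
  assumes "t < Suc n"
  shows "content (encode_coalition n S) (pos 0 + int t) \<noteq> 3"
proof (cases t)
  case (Suc p)
  thus ?thesis using assms content_coalition[of p S] symbol_cases(2) by (simp add: pos_def)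
qed (simp add: content_coalition_ends)

lemma list_word_nth:
  assumes "i < m" "p < Suc n"
  shows "list_word ! (i * Suc n + p) = encode_coalition n (Xs ! i) ! p"
  using assms
proof (induction Xs arbitrary: i)
  case (Cons S Ss)
  thus ?case by (cases i) (auto simp: nth_append add_ac)
qed simp

lemma list_word_index:
  assumes "i < m" "p < Suc n"
  shows "i * Suc n + p < length list_word"
proof -
  have "i * Suc n + p < Suc i * Suc n" using assms(2) by simp
  also have "\<dots> \<le> m * Suc n" using assms(1) by (intro mult_right_mono) auto
  finally show ?thesis by (simp only: length_list_word)
qed

lemma content_list_symbol:
  assumes "i < m" "p < n"
  shows "fX (pos i + 1 + int p) = symbol p (Xs ! i)"
  using content_nth[OF list_word_index, of i p] list_word_nth[of i p] assms
  by (simp add: pos_def encode_coalition_nth algebra_simps)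

lemma content_list_before: "fX (pos 0) = 0"
  by (simp add: pos_def content_eq_0)

lemma content_list_separator:
  assumes "i < m"
  shows "fX (pos (Suc i)) = 3"
  using content_nth[OF list_word_index, of i n] list_word_nth[of i n] assms
  by (simp add: pos_def encode_coalition_eq nth_append algebra_simps)

lemma content_list_after: "fX (pos m + 1) = 0"
  by (rule content_eq_0) (simp add: pos_def length_list_word del: mult_Suc_right)

lemma content_list_nonblank:
  assumes "z < m * Suc n"
  shows "fX (int z) \<noteq> 0"
proof -
  have "list_word ! z \<in> set list_word"
    using assms by (intro nth_mem) (simp only: length_list_word)
  thus ?thesis
    using assms list_word_symbols content_nth[of z list_word]
    by (auto simp: length_list_word simp del: mult_Suc_right)
qed

text \<open>The word \<open>tl ss\<close> handed to \<open>\<delta>\<close> when all heads stand in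
  column \<open>p\<close> of their blocks.\<close>

definition scanned_at :: "nat \<Rightarrow> nat \<Rightarrow> nat \<Rightarrow> nat \<Rightarrow> nat list" where
  "scanned_at i j k p = map (symbol p) [S1, S2, Xs ! i, Xs ! j, Xs ! k]"

text \<open>The columns come in reverse order because blocks are scanned from right to left.\<close>

definition final :: "nat \<Rightarrow> nat \<Rightarrow> nat \<Rightarrow> 'd" where
  "final i j k = fold (\<lambda>p d. \<delta> d (scanned_at i j k p)) (rev [0..<n]) init"

abbreviation "verdict i j k \<equiv> F (final i j k)"

abbreviation heads where
  "heads q r i j k \<equiv> conf q (pos r) (pos i) (pos j) (pos k)"

section \<open>Scanning one block\<close>

lemma scan_letters:
  assumes "i < m" "j < m" "k < m" "t \<le> n"
  shows "(step ^^ t) (conf (Scan, ok, init) (int n - 1) (pos (Suc i) - 1) (pos (Suc j) - 1) (pos (Suc k) - 1)) =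
    conf (Scan, ok, fold (\<lambda>p d. \<delta> d (scanned_at i j k p)) (rev [n - t..<n]) init)
      (int n - 1 - int t) (pos (Suc i) - 1 - int t) (pos (Suc j) - 1 - int t) (pos (Suc k) - 1 - int t)"
  using assms(4)
proof (induction t)
  case (Suc t)
  \<comment> \<open>The column read by the next step; expressing all positions through
    \<open>p\<close> removes the truncated subtraction.\<close>
  define p where "p = n - Suc t"
  have p: "p < n" "n - t = Suc p" "n - Suc t = p" "int n = int p + 1 + int t"
    using Suc.prems by (simp_all add: p_def)
  have h: "pos (Suc l) - 1 - int t = pos l + 1 + int p"
      "pos (Suc l) - 1 - int (Suc t) = pos l + 1 + int p - 1" for l
    by (simp_all add: pos_def p(4))
  have h1: "int n - 1 - int t = int p" "int n - 1 - int (Suc t) = int p - 1"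
    by (simp_all add: p(4))
  have upt: "rev [p..<n] = rev [Suc p..<n] @ [p]"
    using p(1) by (simp add: upt_conv_Cons)
  note IH = Suc.IH[OF Suc_leD[OF Suc.prems], unfolded h h1 p(2)]
  show ?case
    unfolding h h1 p(3) upt funpow.simps o_apply IH using assms(1-3) p(1)
    by (simp add: step_eq trans_def fun_upd_idem content_coalition content_list_symbol
        symbol_cases scanned_at_def del: upt_Suc)
qed simp

text \<open>One step leaves the separators and resets the automaton, then \<open>n\<close> letters
  are read; the cells reached are the ends of the preceding blocks.\<close>

lemma scan_block:
  assumes "i < m" "j < m" "k < m"
  shows "(step ^^ Suc n) (heads (Scan, ok, init) (Suc 0) (Suc i) (Suc j) (Suc k)) =
    heads (Scan, ok, final i j k) 0 i j k"
proof -
  have "step (heads (Scan, ok, init) (Suc 0) (Suc i) (Suc j) (Suc k)) =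
      conf (Scan, ok, init) (int n - 1) (pos (Suc i) - 1) (pos (Suc j) - 1) (pos (Suc k) - 1)"
    by (simp add: step_eq trans_def content_coalition_ends fun_upd_idem) (simp add: pos_def)
  moreover have "pos (Suc l) - 1 - int n = pos l" for l
    by (simp add: pos_def)
  moreover have "int n - 1 - int n = pos 0"
    by (simp add: pos_def)
  ultimately show ?thesis
    using scan_letters[OF assms order.refl, of ok]
    by (simp add: funpow_Suc_right final_def del: funpow.simps upt_Suc)
qed

section \<open>Odometer moves between triples\<close>

lemma pos_add_block: "pos i + int (Suc n) = pos (Suc i)"
  by (simp add: pos_def algebra_simps)

lemma return_C:
  assumes "t \<le> Suc n"
  shows "(step ^^ t) (heads (Next_C, ok, init) 0 i j k) =
    conf (Next_C, ok, init) (pos 0 + int t) (pos i + int t) (pos j + int t) (pos k)"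
  using assms
  by (induction t)
    (simp_all add: step_eq trans_def fun_upd_idem content_coalition_before_end)

lemma return_B:
  assumes "t \<le> Suc n"
  shows "(step ^^ t) (heads (Next_B, True, init) 0 i j k) =
    conf (Next_B, True, init) (pos 0 + int t) (pos i + int t) (pos j) (pos k + int t)"
  using assms
  by (induction t)
    (simp_all add: step_eq trans_def fun_upd_idem content_coalition_before_end)

lemma return_A:
  assumes "t \<le> Suc n"
  shows "(step ^^ t) (heads (Next_A, True, init) 0 i j k) =
    conf (Next_A, True, init) (pos 0 + int t) (pos i) (pos j + int t) (pos k + int t)"
  using assms
  by (induction t)
    (simp_all add: step_eq trans_def fun_upd_idem content_coalition_before_end)

text \<open>Rewinding begins at the first separator, where the return by one block has left the
  exhausted head; up to the last separator it meets no blank.\<close>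

lemma list_nonblank_from_first_separator:
  assumes "t \<le> (m - 1) * Suc n"
  shows "fX (pos (Suc 0) + int t) \<noteq> 0"
proof -
  have "m * Suc n = (m - 1) * Suc n + Suc n"
    using Xs_nonempty by (cases Xs) simp_all
  hence "n + t < m * Suc n" using assms by linarith
  thus ?thesis using content_list_nonblank[of "n + t"] by (simp add: pos_def)
qed

lemma rewind_B:
  assumes "t \<le> Suc ((m - 1) * Suc n)"
  shows "(step ^^ t) (heads (Next_B, True, init) (Suc 0) i j (Suc 0)) =
    conf (Next_B, True, init) (pos (Suc 0)) (pos i) (pos j) (pos (Suc 0) + int t)"
  using assms
proof (induction t)
  case (Suc t)
  thus ?case using list_nonblank_from_first_separator[of t]
    by (simp add: step_eq trans_def fun_upd_idem content_coalition_ends)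
qed simp

text \<open>The heads for \<open>B\<close> and \<open>C\<close> are exhausted together and stand at
  the same position, so the blank seen on tape 5 stops both correctly.\<close>

lemma rewind_A:
  assumes "t \<le> Suc ((m - 1) * Suc n)"
  shows "(step ^^ t) (heads (Next_A, True, init) (Suc 0) i (Suc 0) (Suc 0)) =
    conf (Next_A, True, init) (pos (Suc 0)) (pos i) (pos (Suc 0) + int t) (pos (Suc 0) + int t)"
  using assms
proof (induction t)
  case (Suc t)
  thus ?case using list_nonblank_from_first_separator[of t]
    by (simp add: step_eq trans_def fun_upd_idem content_coalition_ends)
qed simp

lemma pos_after_rewind: "pos (Suc 0) + int (Suc ((m - 1) * Suc n)) = pos m + 1"
  using Xs_nonempty by (cases Xs) (simp_all add: pos_def)

lemma advance_C:
  assumes "k < m"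
  shows "(step ^^ (n + 3)) (heads (Scan, ok, d) 0 i j (Suc k)) =
    heads (Scan, ok \<and> F d, init) (Suc 0) (Suc i) (Suc j) (Suc k)"
proof -
  have "step (heads (Scan, ok, d) 0 i j (Suc k)) = heads (Next_C, ok \<and> F d, init) 0 i j (Suc k)"
    using assms by (simp add: step_eq trans_def content_coalition_ends fun_upd_idem
        content_list_separator numeral_eq_Suc)
  moreover have "step (heads (Next_C, ok', init) (Suc 0) (Suc i) (Suc j) (Suc k)) =
      heads (Scan, ok', init) (Suc 0) (Suc i) (Suc j) (Suc k)" for ok'
    by (simp add: step_eq trans_def content_coalition_ends fun_upd_idem numeral_eq_Suc)
  \<comment> \<open>One step out of \<open>Scan\<close>, \<open>n + 1\<close> moves back, one step
    to restart; the head for \<open>C\<close> stays put and thereby advances relative to the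
    others.\<close>
  moreover have "n + 3 = Suc (Suc n + Suc 0)" by simp
  ultimately show ?thesis
    using return_C[OF order.refl, of "ok \<and> F d" i j "Suc k"]
    by (simp only: funpow_add funpow.simps o_apply id_apply pos_add_block)
qed

lemma length_positive: "Suc ((m - 1) * Suc n) + Suc n = Suc (m * Suc n)"
  using Xs_nonempty by (cases Xs) simp_all

lemma advance_B:
  assumes "j < m" "\<not> (ok \<and> F d)"
  shows "(step ^^ (m * Suc n + 3)) (heads (Scan, ok, d) 0 i (Suc j) 0) =
    heads (Scan, True, init) (Suc 0) (Suc i) (Suc j) m"
proof -
  have "step (heads (Scan, ok, d) 0 i (Suc j) 0) = heads (Next_B, True, init) 0 i (Suc j) 0"
    using assms by (auto simp: step_eq trans_def content_coalition_ends fun_upd_idem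
        content_list_separator content_list_before numeral_eq_Suc)
  moreover have "step (conf (Next_B, True, init) (pos (Suc 0)) (pos (Suc i)) (pos (Suc j)) (pos m + 1)) =
      heads (Scan, True, init) (Suc 0) (Suc i) (Suc j) m"
    by (simp add: step_eq trans_def content_coalition_ends fun_upd_idem content_list_after
        numeral_eq_Suc)
  \<comment> \<open>One step out of \<open>Scan\<close>, \<open>n + 1\<close> return moves,
    rewinding by the other \<open>m - 1\<close> blocks and one cell further onto the blank, one step
    back onto the last separator.\<close>
  moreover have "m * Suc n + 3 = Suc (Suc ((m - 1) * Suc n) + (Suc n + Suc 0))"
    using length_positive by linarith
  ultimately show ?thesis
    using return_B[OF order.refl, of i "Suc j" 0] rewind_B[OF order.refl, of "Suc i" "Suc j"]
    by (simp only: funpow_add funpow.simps o_apply id_apply pos_add_block pos_after_rewind)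
qed

lemma advance_A:
  assumes "i < m" "\<not> (ok \<and> F d)"
  shows "(step ^^ (m * Suc n + 3)) (heads (Scan, ok, d) 0 (Suc i) 0 0) =
    heads (Scan, True, init) (Suc 0) (Suc i) m m"
proof -
  have "step (heads (Scan, ok, d) 0 (Suc i) 0 0) = heads (Next_A, True, init) 0 (Suc i) 0 0"
    using assms by (auto simp: step_eq trans_def content_coalition_ends fun_upd_idem
        content_list_separator content_list_before numeral_eq_Suc)
  moreover have "step (conf (Next_A, True, init) (pos (Suc 0)) (pos (Suc i)) (pos m + 1) (pos m + 1)) =
      heads (Scan, True, init) (Suc 0) (Suc i) m m"
    by (simp add: step_eq trans_def content_coalition_ends fun_upd_idem content_list_after
        numeral_eq_Suc)
  moreover have "m * Suc n + 3 = Suc (Suc ((m - 1) * Suc n) + (Suc n + Suc 0))"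
    using length_positive by linarith
  ultimately show ?thesis
    using return_A[OF order.refl, of "Suc i" 0 0] rewind_A[OF order.refl, of "Suc i"]
    by (simp only: funpow_add funpow.simps o_apply id_apply pos_add_block pos_after_rewind)
qed

lemma halt_accept:
  "ok \<and> F d \<Longrightarrow> step (heads (Scan, ok, d) 0 i j 0) = heads acc 0 i j 0"
  by (simp add: step_eq trans_def content_coalition_ends fun_upd_idem content_list_before
      numeral_eq_Suc)

lemma halt_reject:
  "\<not> (ok \<and> F d) \<Longrightarrow> step (heads (Scan, ok, d) 0 0 0 0) = heads rej 0 0 0 0"
  by (auto simp: step_eq trans_def content_coalition_ends fun_upd_idem content_list_before
      numeral_eq_Suc)

section \<open>The search through all triples and its running time\<close>

definition ends where
  "ends t c v \<longleftrightarrow> (\<exists>s\<le>t. fst ((step ^^ s) c) = (if v then acc else rej))"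

lemma ends_after:
  assumes "(step ^^ s) c = c'" "ends t c' v"
  shows "ends (s + t) c v"
proof -
  obtain r where r: "r \<le> t" "fst ((step ^^ r) c') = (if v then acc else rej)"
    using assms(2) by (auto simp: ends_def)
  hence "fst ((step ^^ (r + s)) c) = (if v then acc else rej)"
    using assms(1) by (simp only: funpow_add o_apply)
  thus ?thesis unfolding ends_def using r(1) by (intro exI[of _ "r + s"]) auto
qed

lemma ends_mono: "ends t c v \<Longrightarrow> t \<le> t' \<Longrightarrow> ends t' c v"
  using order.trans unfolding ends_def by blast

text \<open>The cost of scanning one block and of the most expensive odometer move, one that rewinds
  a list.\<close>

definition triple_time :: nat where
  "triple_time = Suc n + (m * Suc n + 3)"

abbreviation start where
  "start ok i j k \<equiv> heads (Scan, ok, init) (Suc 0) (Suc i) (Suc j) (Suc k)"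

lemma start_next_C:
  assumes "i < m" "j < m" "Suc k < m"
    and "ends t (start (ok \<and> verdict i j (Suc k)) i j k) v"
  shows "ends (triple_time + t) (start ok i j (Suc k)) v"
proof (rule ends_mono)
  show "ends (Suc n + ((n + 3) + t)) (start ok i j (Suc k)) v"
    by (rule ends_after[OF scan_block[OF assms(1-3)] ends_after[OF advance_C assms(4)]])
      (use assms(3) in simp)
qed (use length_positive in \<open>simp add: triple_time_def\<close>)

lemma start_next_B:
  assumes "i < m" "Suc j < m" "\<not> (ok \<and> verdict i (Suc j) 0)"
    and "ends t (start True i j (m - 1)) v"
  shows "ends (triple_time + t) (start ok i (Suc j) 0) v"
proof -
  have m: "0 < m" "Suc (m - 1) = m" "j < m" using Xs_nonempty assms(2) by auto
  have "ends (Suc n + ((m * Suc n + 3) + t)) (start ok i (Suc j) 0) v"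
    by (rule ends_after[OF scan_block[OF assms(1,2) m(1)]
        ends_after[OF advance_B[OF m(3) assms(3)] assms(4)[unfolded m(2)]]])
  thus ?thesis by (simp add: triple_time_def add.assoc)
qed

lemma start_next_A:
  assumes "Suc i < m" "\<not> (ok \<and> verdict (Suc i) 0 0)"
    and "ends t (start True i (m - 1) (m - 1)) v"
  shows "ends (triple_time + t) (start ok (Suc i) 0 0) v"
proof -
  have m: "0 < m" "Suc (m - 1) = m" "i < m" using Xs_nonempty assms(1) by auto
  have "ends (Suc n + ((m * Suc n + 3) + t)) (start ok (Suc i) 0 0) v"
    by (rule ends_after[OF scan_block[OF assms(1) m(1,1)]
        ends_after[OF advance_A[OF m(3) assms(2)] assms(3)[unfolded m(2)]]])
  thus ?thesis by (simp add: triple_time_def add.assoc)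
qed

lemma ends_accept: "fst c = acc \<Longrightarrow> ends 0 c True"
  and ends_reject: "fst c = rej \<Longrightarrow> ends 0 c False"
  by (simp_all add: ends_def)

lemma start_accept:
  assumes "i < m" "j < m" "ok \<and> verdict i j 0"
  shows "ends triple_time (start ok i j 0) True"
proof (rule ends_mono)
  have "(step ^^ 1) (heads (Scan, ok, final i j 0) 0 i j 0) = heads acc 0 i j 0"
    using halt_accept[OF assms(3), of i j] by simp
  thus "ends (Suc n + (1 + 0)) (start ok i j 0) True"
    using Xs_nonempty
    by (intro ends_after[OF scan_block[OF assms(1,2)]] ends_after[OF _ ends_accept]) auto
qed (simp add: triple_time_def)

lemma start_reject:
  assumes "\<not> (ok \<and> verdict 0 0 0)"
  shows "ends triple_time (start ok 0 0 0) False"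
proof (rule ends_mono)
  have "(step ^^ 1) (heads (Scan, ok, final 0 0 0) 0 0 0 0) = heads rej 0 0 0 0"
    using halt_reject[OF assms] by simp
  thus "ends (Suc n + (1 + 0)) (start ok 0 0 0) False"
    using Xs_nonempty
    by (intro ends_after[OF scan_block] ends_after[OF _ ends_reject]) auto
qed (simp add: triple_time_def)

text \<open>The triples that remain to be examined are those lexicographically up to \<open>(i, j, k)\<close>;
  the flag \<open>ok\<close> records the verdicts on \<open>(i, j, k')\<close> for all \<open>k' > k\<close>.\<close>

definition pending :: "bool \<Rightarrow> nat \<Rightarrow> nat \<Rightarrow> nat \<Rightarrow> bool" where
  "pending ok i j k \<longleftrightarrow> (ok \<and> (\<forall>k'\<le>k. verdict i j k')) \<or>
     (\<exists>j'<j. \<forall>k'<m. verdict i j' k') \<or> (\<exists>i'<i. \<exists>j'<m. \<forall>k'<m. verdict i' j' k')"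

text \<open>The rank of a triple, read as a number in base \<open>m\<close>, drops by exactly one
  with each odometer move. This serves both as induction measure and as time bound, while
  \<open>pending\<close> is preserved by every move.\<close>

lemma search_run:
  assumes "i < m" "j < m" "k < m"
  shows "ends (triple_time * (i * m * m + j * m + k + 1)) (start ok i j k) (pending ok i j k)"
  using assms
proof (induction "i * m * m + j * m + k" arbitrary: i j k ok rule: less_induct)
  case less
  have m: "0 < m" using Xs_nonempty by simp
  hence last: "l \<le> m - 1 \<longleftrightarrow> l < m" for l by arith
  have m_step: "l * m + (m - 1) + 1 = Suc l * m" for l
    using m by simp
  \<comment> \<open>For \<open>k = 0\<close> the flag and the verdict together settle the pair
    \<open>(i, j)\<close>: it is accepted, or the search passes to the next pair, if there is
    one.\<close>
  consider (C) k' where "k = Suc k'"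
    | (accept) "k = 0" "ok \<and> verdict i j 0"
    | (B) j' where "k = 0" "\<not> (ok \<and> verdict i j 0)" "j = Suc j'"
    | (A) i' where "k = 0" "\<not> (ok \<and> verdict i j 0)" "j = 0" "i = Suc i'"
    | (reject) "k = 0" "\<not> (ok \<and> verdict i j 0)" "j = 0" "i = 0"
    by (cases k; cases j; cases i) auto
  thus ?case
  proof cases
    case C
    \<comment> \<open>The verdict on \<open>(i, j, Suc k')\<close> passes from the quantifier into
      the flag.\<close>
    have v: "pending (ok \<and> verdict i j (Suc k')) i j k' = pending ok i j (Suc k')"
      by (auto simp: pending_def le_Suc_eq)
    show ?thesis
      using start_next_C[OF less.prems(1,2) less.prems(3)[unfolded C]
          less.hyps[of i j k' "ok \<and> verdict i j (Suc k')", unfolded v]] less.prems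
      by (simp add: C)
  next
    case accept
    moreover from this have "pending ok i j k" by (simp add: pending_def)
    ultimately show ?thesis
      using start_accept[OF less.prems(1,2) accept(2)] by (auto elim: ends_mono)
  next
    case B
    \<comment> \<open>The pair \<open>(i, Suc j')\<close> has failed, which removes its disjunct;
      the pair \<open>(i, j')\<close> starts with a fresh flag and all \<open>C\<close>
      ahead.\<close>
    have v: "pending True i j' (m - 1) = pending ok i (Suc j') 0"
      using B by (auto simp: pending_def less_Suc_eq last simp del: One_nat_def)
    have t: "i * m * m + j' * m + (m - 1) + 1 = i * m * m + j * m + k"
      using m_step[of j'] B by simp
    show ?thesis
      using start_next_B[OF less.prems(1) less.prems(2)[unfolded B(3)] B(2)[unfolded B(3)]
          less.hyps[of i j' "m - 1" True, unfolded v t]] less.prems t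
      by (simp add: B)
  next
    case A
    have v: "pending True i' (m - 1) (m - 1) = pending ok (Suc i') 0 0"
      using A by (auto simp: pending_def less_Suc_eq last[symmetric] le_less simp del: One_nat_def)
    \<comment> \<open>The carry in base \<open>m\<close>: both lower digits restart at
      \<open>m - 1\<close>.\<close>
    have "(m - 1) * m + (m - 1) + 1 = m * m"
      unfolding m_step using m by simp
    hence "i' * m * m + (m - 1) * m + (m - 1) + 1 = i' * m * m + m * m"
      by linarith
    hence t: "i' * m * m + (m - 1) * m + (m - 1) + 1 = i * m * m + j * m + k"
      by (simp add: A algebra_simps)
    show ?thesis
      using start_next_A[OF less.prems(1)[unfolded A(4)] A(2)[unfolded A(3,4)]
          less.hyps[of i' "m - 1" "m - 1" True, unfolded v t]] less.prems t
      by (simp add: A)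
  next
    case reject
    hence "\<not> pending ok i j k" by (simp add: pending_def)
    thus ?thesis
      using start_reject[of ok] reject by simp
  qed
qed

lemma length_input: "length input = (m + 3) * Suc n"
  by (simp add: input_def length_list_word algebra_simps del: length_concat)

lemma decision_run:
  "ends (length input + 1 + (length input + 3) * length input ^ 3)
    ((Skip, True, init), word_tape input # replicate 5 (word_tape []))
    (\<exists>A\<in>set Xs. \<exists>B\<in>set Xs. \<forall>C\<in>set Xs.
      F (fold (\<lambda>p d. \<delta> d (map (symbol p) [S1, S2, A, B, C])) (rev [0..<n]) init))"
    (is "ends _ _ ?v")
proof -
  define l where "l = m - 1"
  have l: "m = Suc l" "l < m" using Xs_nonempty by (auto simp: l_def)
  have ex_nth: "(\<exists>A\<in>set Xs. P A) \<longleftrightarrow> (\<exists>i<m. P (Xs ! i))" for P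
    using all_set_conv_all_nth[of Xs "\<lambda>A. \<not> P A"] by blast
  have "pending True l l l \<longleftrightarrow> (\<exists>i<m. \<exists>j<m. \<forall>k<m. verdict i j k)"
    by (auto simp: pending_def l(1) less_Suc_eq_le le_less)
  also have "\<dots> \<longleftrightarrow> ?v"
    by (simp add: final_def scanned_at_def ex_nth all_set_conv_all_nth)
  finally have v: "pending True l l l = ?v" .
  have pos_m: "pos (Suc 0) = int n" "pos (Suc l) = int (m * Suc n) - 1"
    by (simp_all add: pos_def l(1))
  \<comment> \<open>A triple costs \<open>(m + 1) * Suc n + 3\<close>, while the input has length
    \<open>(m + 3) * Suc n\<close>.\<close>
  have T: "triple_time \<le> length input + 3"
    unfolding length_input triple_time_def distrib_right by simp
  have "l * m * m + l * m + l + 1 = m ^ 3"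
    by (simp add: l(1) power3_eq_cube algebra_simps)
  also have "m ^ 3 \<le> length input ^ 3"
    by (intro power_mono) (simp_all add: length_input)
  finally have "triple_time * (l * m * m + l * m + l + 1) \<le> (length input + 3) * length input ^ 3"
    using T by (intro mult_mono) simp_all
  hence "ends ((length input + 3) * length input ^ 3) (start True l l l) ?v"
    using search_run[OF l(2) l(2) l(2), of True] unfolding v by (rule ends_mono[rotated])
  thus ?thesis
    by (rule ends_after[OF setup_run[folded pos_m]])
qed

end

text \<open>At most cubically many triples are tried, each in time linear in the input; what remains
  for a representation is to supply an automaton on columns.\<close>

theorem (in triple_machine) solvable_by_triple_search:
  assumes nonempty: "\<And>n W Xs S1 S2. (n, W, Xs, S1, S2) \<in> D \<Longrightarrow> Xs \<noteq> []"
    and Q: "\<And>n W Xs S1 S2. (n, W, Xs, S1, S2) \<in> D \<Longrightarrow> Q (n, W, Xs, S1, S2) \<longleftrightarrow>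
      (\<exists>A\<in>set Xs. \<exists>B\<in>set Xs. \<forall>C\<in>set Xs.
        F (fold (\<lambda>p d. \<delta> d (map (symbol p) [S1, S2, A, B, C])) (rev [0..<n]) init))"
  shows "solvable_in_polynomial_time D encode_instance Q"
\<comment> \<open>The four symbols are the blank, two digits and the separator; the polynomial adds
  the setup time to the search time.\<close>
proof (rule solvable_in_polynomial_time_finite_control[where k = 6 and a = 4 and \<tau> = \<tau>
      and acc = acc and rej = rej and ?q0.0 = "(Skip, True, init)"
      and p = "[:1, 1:] + [:3, 1:] * [:0, 1:] ^ 3"])
  fix x assume "x \<in> D"
  obtain n W Xs S1 S2 where x: "x = (n, W, Xs, S1, S2)" by (cases x)
  have D: "(n, W, Xs, S1, S2) \<in> D" using \<open>x \<in> D\<close> x by simp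
  show "set (encode_instance x) \<subseteq> {1..<4}"
    by (auto simp: x encode_instance_def dest!: subsetD[OF set_encode_coalition])
  interpret triple_run \<delta> init F n S1 S2 Xs
    by unfold_locales (rule nonempty[OF D])
  have poly: "poly ([:1, 1:] + [:3, 1:] * [:0, 1:] ^ 3) l = l + 1 + (l + 3) * l ^ 3" for l :: nat
    by (simp add: algebra_simps)
  have "encode_instance x = input" by (simp add: x encode_instance_def input_def)
  thus "\<exists>t\<le>poly ([:1, 1:] + [:3, 1:] * [:0, 1:] ^ 3) (length (encode_instance x)).
      fst ((step ^^ t) ((Skip, True, init),
        word_tape (encode_instance x) # replicate (6 - 1) (word_tape []))) = (if Q x then acc else rej)"
    using decision_run unfolding ends_def x Q[OF D] by (simp only: poly) simp
qed (use \<tau>_wf in auto)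


section \<open>The three representations\<close>

lemma card_filter_pair:
  assumes "a \<noteq> b"
  shows "card {i \<in> {a, b}. P i} = of_bool (P a) + of_bool (P b)"
proof -
  have "{i \<in> {a, b}. P i} = (if P a then {a} else {}) \<union> (if P b then {b} else {})" by auto
  thus ?thesis using assms by simp
qed

text \<open>The winning pattern forces \<open>I = {0, 1}\<close>, and then the balance condition
  compares two sums of two bits for every player.\<close>

lemma trade_application_2_iff:
  assumes "S1 \<in> W" "S2 \<in> W" "S3 \<notin> W" "S4 \<notin> W"
    and "S1 \<subseteq> N" "S2 \<subseteq> N" "S3 \<subseteq> N" "S4 \<subseteq> N"
  shows "trade_application N W 2 [S1, S2, S3, S4] \<longleftrightarrow> S1 \<inter> S2 = S3 \<inter> S4 \<and> S1 \<union> S2 = S3 \<union> S4"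
proof -
  let ?Ss = "[S1, S2, S3, S4]"
  have four: "{..<4} = {0, 1, 2, 3 :: nat}" by auto
  have wins: "(\<forall>i<4. ?Ss ! i \<in> W \<longleftrightarrow> i \<in> I) \<longleftrightarrow> I = {0, 1}" if "I \<subseteq> {..<4}" for I
  proof -
    have "(\<forall>i<4. ?Ss ! i \<in> W \<longleftrightarrow> i \<in> I) \<longleftrightarrow> (\<forall>i\<in>{0, 1, 2, 3}. ?Ss ! i \<in> W \<longleftrightarrow> i \<in> I)"
      unfolding four[symmetric] by auto
    also have "\<dots> \<longleftrightarrow> 0 \<in> I \<and> 1 \<in> I \<and> 2 \<notin> I \<and> 3 \<notin> I"
      using assms(1-4) by (simp only: ball_simps nth_Cons_0 nth_Cons_numeral diff_Suc_1) simp
    also have "\<dots> \<longleftrightarrow> I = {0, 1}"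
    proof -
      have "i = 0 \<or> i = 1 \<or> i = 2 \<or> i = 3" if "i \<in> I" for i
        using that \<open>I \<subseteq> {..<4}\<close> four by blast
      hence "I = {0, 1}" if "0 \<in> I \<and> 1 \<in> I \<and> 2 \<notin> I \<and> 3 \<notin> I"
        using that by blast
      moreover have "0 \<in> I \<and> 1 \<in> I \<and> 2 \<notin> I \<and> 3 \<notin> I" if "I = {0, 1}"
        unfolding that by simp
      ultimately show ?thesis by (rule iffI)
    qed
    finally show ?thesis .
  qed
  have rest: "{..<4} - {0, 1} = {2, 3 :: nat}" by auto
  have "trade_application N W 2 ?Ss \<longleftrightarrow>
      (\<exists>I\<subseteq>{..<4}. card I = 2 \<and> I = {0, 1} \<and>
        (\<forall>p\<in>N. card {i \<in> I. p \<in> ?Ss ! i} = card {i \<in> {..<4} - I. p \<in> ?Ss ! i}))"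
  proof -
    have "(\<exists>I\<subseteq>{..<4}. card I = 2 \<and> (\<forall>i<4. ?Ss ! i \<in> W \<longleftrightarrow> i \<in> I) \<and> R I) \<longleftrightarrow>
        (\<exists>I\<subseteq>{..<4}. card I = 2 \<and> I = {0, 1} \<and> R I)" for R
      using wins by blast
    moreover have "length ?Ss = 2 * 2" "set ?Ss \<subseteq> Pow N" "2 * 2 = (4 :: nat)"
      using assms(5-8) by simp_all
    ultimately show ?thesis unfolding trade_application_def by (simp only: simp_thms)
  qed
  also have "\<dots> \<longleftrightarrow>
      (\<forall>p\<in>N. card {i \<in> {0, 1}. p \<in> ?Ss ! i} = card {i \<in> {2, 3}. p \<in> ?Ss ! i})"
  proof -
    have "{0, 1 :: nat} \<subseteq> {..<4}" "card {0, 1 :: nat} = 2" by auto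
    hence "(\<exists>I\<subseteq>{..<4}. card I = 2 \<and> I = {0, 1 :: nat} \<and> R I) \<longleftrightarrow> R {0, 1}" for R
      by blast
    thus ?thesis unfolding rest[symmetric] .
  qed
  also have "\<dots> \<longleftrightarrow> (\<forall>p\<in>N. of_bool (p \<in> S1) + of_bool (p \<in> S2) = (of_bool (p \<in> S3) + of_bool (p \<in> S4) :: nat))"
    by (simp add: card_filter_pair del: insert_iff)
  also have "\<dots> \<longleftrightarrow> S1 \<inter> S2 = S3 \<inter> S4 \<and> S1 \<union> S2 = S3 \<union> S4"
  proof -
    \<comment> \<open>A sum of two bits is determined by their conjunction and disjunction, and
      determines both.\<close>
    have "of_bool a + of_bool b = (of_bool c + of_bool d :: nat) \<longleftrightarrow>
        (a \<and> b \<longleftrightarrow> c \<and> d) \<and> (a \<or> b \<longleftrightarrow> c \<or> d)" for a b c d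
      by (cases a; cases b; cases c; cases d) auto
    moreover have "S1 \<inter> S2 = S3 \<inter> S4 \<and> S1 \<union> S2 = S3 \<union> S4 \<longleftrightarrow>
        (\<forall>p\<in>N. (p \<in> S1 \<and> p \<in> S2 \<longleftrightarrow> p \<in> S3 \<and> p \<in> S4) \<and> (p \<in> S1 \<or> p \<in> S2 \<longleftrightarrow> p \<in> S3 \<or> p \<in> S4))"
      using assms(5-8) by blast
    ultimately show ?thesis by (simp only:)
  qed
  finally show ?thesis .
qed

lemma extends_to_2_trade_iff:
  assumes "S1 \<in> W" "S2 \<in> W" "W \<subseteq> Pow {1..n}"
  shows "extends_to_2_trade (n, W, Xs, S1, S2) \<longleftrightarrow>
    (\<exists>S3\<in>Pow {1..n} - W. \<exists>S4\<in>Pow {1..n} - W. S1 \<inter> S2 = S3 \<inter> S4 \<and> S1 \<union> S2 = S3 \<union> S4)"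
proof -
  have "S1 \<subseteq> {1..n}" "S2 \<subseteq> {1..n}" using assms by auto
  thus ?thesis
    unfolding extends_to_2_trade_def losing_coalitions_def
    using trade_application_2_iff[OF assms(1,2), where N = "{1..n}"]
    by (auto intro!: bex_cong)
qed

section \<open>Losing and maximal losing coalitions\<close>

lemma losing_subset_maximal:
  assumes "finite N" "S \<in> losing_coalitions N W"
  shows "\<exists>T\<in>maximal_losing_coalitions N W. S \<subseteq> T"
proof -
  have "finite (losing_coalitions N W)" using assms(1) by (simp add: losing_coalitions_def)
  then obtain T where T: "T \<in> losing_coalitions N W" "S \<subseteq> T"
    "\<forall>U\<in>losing_coalitions N W. T \<subseteq> U \<longrightarrow> T = U"
    using finite_has_maximal2[OF _ assms(2)] by blast
  have "U \<in> W" if "T \<subset> U" "U \<subseteq> N" for U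
  proof (rule ccontr)
    assume "U \<notin> W"
    hence "U \<in> losing_coalitions N W" using that(2) by (simp add: losing_coalitions_def)
    thus False using T(3) that(1) by blast
  qed
  hence "T \<in> maximal_losing_coalitions N W" using T(1) by (simp add: maximal_losing_coalitions_def)
  thus ?thesis using T(2) by blast
qed

text \<open>Losing coalitions are closed under subsets: an exact pair can be enlarged to members of
  a cofinal family \<open>Y\<close>, and a covering pair can be trimmed to an exact one.\<close>

lemma extends_to_2_trade_iff_cover:
  assumes game: "simple_game {1..n} W" and "S1 \<in> W" "S2 \<in> W"
    and losing: "Y \<subseteq> Pow {1..n} - W" and cofinal: "\<And>S. S \<in> Pow {1..n} - W \<Longrightarrow> \<exists>T\<in>Y. S \<subseteq> T"
  shows "extends_to_2_trade (n, W, Xs, S1, S2) \<longleftrightarrow>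
    (\<exists>A\<in>Y. \<exists>B\<in>Y. S1 \<inter> S2 \<subseteq> A \<inter> B \<and> S1 \<union> S2 \<subseteq> A \<union> B)" (is "?l \<longleftrightarrow> ?r")
proof -
  have W: "W \<subseteq> Pow {1..n}" and up: "\<And>S T. S \<in> W \<Longrightarrow> S \<subseteq> T \<Longrightarrow> T \<subseteq> {1..n} \<Longrightarrow> T \<in> W"
    using game by (auto simp: simple_game_def)
  note iff = extends_to_2_trade_iff[OF assms(2,3) W, of Xs]
  show ?thesis
  proof
    assume ?l
    then obtain S3 S4 where S: "S3 \<in> Pow {1..n} - W" "S4 \<in> Pow {1..n} - W"
        "S1 \<inter> S2 = S3 \<inter> S4" "S1 \<union> S2 = S3 \<union> S4"
      unfolding iff by blast
    obtain A B where "A \<in> Y" "B \<in> Y" "S3 \<subseteq> A" "S4 \<subseteq> B"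
      using cofinal[OF S(1)] cofinal[OF S(2)] by blast
    thus ?r unfolding S(3,4) by blast
  next
    assume ?r
    then obtain A B where AB: "A \<in> Y" "B \<in> Y" "S1 \<inter> S2 \<subseteq> A \<inter> B" "S1 \<union> S2 \<subseteq> A \<union> B" by blast
    \<comment> \<open>\<open>S3\<close> takes all that \<open>A\<close> offers of the union;
      \<open>S4\<close> takes the intersection and the leftover, which the covering condition places
      inside \<open>B\<close>.\<close>
    define S3 S4 where "S3 = (S1 \<union> S2) \<inter> A" and "S4 = (S1 \<inter> S2) \<union> ((S1 \<union> S2) - A)"
    have sub: "S3 \<subseteq> A" "S4 \<subseteq> B" using AB by (auto simp: S3_def S4_def)
    have "S3 \<in> Pow {1..n} - W" "S4 \<in> Pow {1..n} - W"
      using sub up losing AB(1,2) by blast+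
    moreover have "S1 \<inter> S2 = S3 \<inter> S4" "S1 \<union> S2 = S3 \<union> S4"
      using AB(3) by (auto simp: S3_def S4_def)
    ultimately show ?l unfolding iff by blast
  qed
qed

text \<open>Membership of a single player in the candidate, as a function of bits, so that an
  automaton can evaluate it in one column. \<open>A\<close> decides on \<open>S2 - S1\<close> and
  \<open>B\<close> on \<open>S1 - S2\<close>.\<close>

definition in_S3 :: "bool \<Rightarrow> bool \<Rightarrow> bool \<Rightarrow> bool \<Rightarrow> bool" where
  "in_S3 s1 s2 a b \<longleftrightarrow> (s1 \<and> s2) \<or> (a \<and> s2 \<and> \<not> s1) \<or> (b \<and> s1 \<and> \<not> s2)"

definition in_S4 :: "bool \<Rightarrow> bool \<Rightarrow> bool \<Rightarrow> bool \<Rightarrow> bool" where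
  "in_S4 s1 s2 a b \<longleftrightarrow> (s1 \<and> s2) \<or> ((s1 \<or> s2) \<and> \<not> in_S3 s1 s2 a b)"

text \<open>There may be exponentially many candidates for \<open>S3\<close>, but each of them arises from a pair of winning
  coalitions: \<open>S1 \<union> S3\<close> determines \<open>S3\<close> on \<open>S2 - S1\<close>, and \<open>S2 \<union> S3\<close> determines it on \<open>S1 - S2\<close>.\<close>

lemma extends_to_2_trade_iff_winning:
  assumes game: "simple_game {1..n} W" and "S1 \<in> W" "S2 \<in> W"
  shows "extends_to_2_trade (n, W, Xs, S1, S2) \<longleftrightarrow>
    (\<exists>A\<in>W. \<exists>B\<in>W. \<forall>C\<in>W.
      C \<noteq> {p. in_S3 (p \<in> S1) (p \<in> S2) (p \<in> A) (p \<in> B)} \<and>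
      C \<noteq> {p. in_S4 (p \<in> S1) (p \<in> S2) (p \<in> A) (p \<in> B)})" (is "?l \<longleftrightarrow> ?r")
proof -
  have W: "W \<subseteq> Pow {1..n}" and up: "\<And>S T. S \<in> W \<Longrightarrow> S \<subseteq> T \<Longrightarrow> T \<subseteq> {1..n} \<Longrightarrow> T \<in> W"
    using game by (auto simp: simple_game_def)
  have S12: "S1 \<subseteq> {1..n}" "S2 \<subseteq> {1..n}" using assms(2,3) W by auto
  note iff = extends_to_2_trade_iff[OF assms(2,3) W, of Xs]
  show ?thesis
  proof
    assume ?l
    then obtain S3 S4 where S: "S3 \<in> Pow {1..n} - W" "S4 \<in> Pow {1..n} - W"
        "S1 \<inter> S2 = S3 \<inter> S4" "S1 \<union> S2 = S3 \<union> S4"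
      unfolding iff by blast
    \<comment> \<open>Supersets of the winning \<open>S1\<close> and \<open>S2\<close> are winning,
      so these witnesses for \<open>A\<close> and \<open>B\<close> occur in the list.\<close>
    have AB: "S1 \<union> S3 \<in> W" "S2 \<union> S3 \<in> W"
      using up[OF assms(2), of "S1 \<union> S3"] up[OF assms(3), of "S2 \<union> S3"] S(1) S12 by auto
    have eqs: "{p. in_S3 (p \<in> S1) (p \<in> S2) (p \<in> S1 \<union> S3) (p \<in> S2 \<union> S3)} = S3"
        "{p. in_S4 (p \<in> S1) (p \<in> S2) (p \<in> S1 \<union> S3) (p \<in> S2 \<union> S3)} = S4"
      unfolding in_S4_def in_S3_def using S(3,4) by blast+
    show ?r
      by (rule bexI[OF bexI[OF _ AB(2)] AB(1)], unfold eqs) (use S(1,2) in blast)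
  next
    assume ?r
    then obtain A B where AB: "\<forall>C\<in>W. C \<noteq> {p. in_S3 (p \<in> S1) (p \<in> S2) (p \<in> A) (p \<in> B)} \<and>
        C \<noteq> {p. in_S4 (p \<in> S1) (p \<in> S2) (p \<in> A) (p \<in> B)}" by blast
    let ?S3 = "{p. in_S3 (p \<in> S1) (p \<in> S2) (p \<in> A) (p \<in> B)}"
    let ?S4 = "{p. in_S4 (p \<in> S1) (p \<in> S2) (p \<in> A) (p \<in> B)}"
    \<comment> \<open>Every choice of \<open>A\<close> and \<open>B\<close> yields the right union
      and intersection, so the comparison with all \<open>C\<close> only has to certify that both
      candidates lose.\<close>
    have U: "?S3 \<union> ?S4 = S1 \<union> S2" "?S3 \<inter> ?S4 = S1 \<inter> S2"
      unfolding in_S4_def in_S3_def by blast+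
    have "?S3 \<subseteq> {1..n}" "?S4 \<subseteq> {1..n}" using U(1) S12 by blast+
    moreover have "?S3 \<notin> W" "?S4 \<notin> W" using AB by blast+
    ultimately have "?S3 \<in> Pow {1..n} - W" "?S4 \<in> Pow {1..n} - W" by simp_all
    thus ?l unfolding iff using U[symmetric] by (intro bexI[of _ ?S3] bexI[of _ ?S4] conjI)
  qed
qed

section \<open>Automata for the column tests\<close>

lemma fold_conj: "fold (\<lambda>p d. d \<and> P p) ps b \<longleftrightarrow> b \<and> (\<forall>p\<in>set ps. P p)"
  by (induction ps arbitrary: b) auto

lemma fold_disj_pair:
  "fold (\<lambda>p d. (fst d \<or> P p, snd d \<or> Q p)) ps b =
    (fst b \<or> (\<exists>p\<in>set ps. P p), snd b \<or> (\<exists>p\<in>set ps. Q p))"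
  by (induction ps arbitrary: b) auto

lemma symbol_eq_2: "symbol p S = 2 \<longleftrightarrow> Suc p \<in> S"
  by (simp add: symbol_def)

lemma all_players: "(\<forall>p<n. P (Suc p)) \<longleftrightarrow> (\<forall>p\<in>{1..n}. P p)"
proof -
  have "{1..n} = Suc ` {..<n}" by (simp add: image_Suc_lessThan)
  thus ?thesis by auto
qed

text \<open>One bit suffices as automaton state: both inclusions of the covering criterion are
  checked column by column.\<close>

theorem solvable_from_losing:
  assumes fam: "\<And>n W. simple_game {1..n} W \<Longrightarrow> X {1..n} W \<subseteq> Pow {1..n} - W"
    and cofinal: "\<And>n W S. simple_game {1..n} W \<Longrightarrow> S \<in> Pow {1..n} - W \<Longrightarrow> \<exists>T\<in>X {1..n} W. S \<subseteq> T"
  shows "solvable_in_polynomial_time (trade_instances X) encode_instance extends_to_2_trade"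
proof -
  let ?ok = "\<lambda>l :: nat list. (l ! 0 = 2 \<and> l ! 1 = 2 \<longrightarrow> l ! 2 = 2 \<and> l ! 3 = 2) \<and>
    (l ! 0 = 2 \<or> l ! 1 = 2 \<longrightarrow> l ! 2 = 2 \<or> l ! 3 = 2)"
  show ?thesis
  proof (rule triple_machine.solvable_by_triple_search[where
        \<delta> = "\<lambda>d l. d \<and> ?ok l" and init = True and F = "\<lambda>d. d"])
    fix n W Xs S1 S2 assume "(n, W, Xs, S1, S2) \<in> trade_instances X"
    hence game: "simple_game {1..n} W" and Xs: "set Xs = X {1..n} W" and S: "S1 \<in> W" "S2 \<in> W"
      by (auto simp: trade_instances_def)
    \<comment> \<open>The empty coalition loses, so cofinality produces a member of the
      family.\<close>
    have "{} \<in> Pow {1..n} - W" using game by (auto simp: simple_game_def)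
    thus "Xs \<noteq> []" using cofinal[OF game] Xs by fastforce
    have sub: "S1 \<subseteq> {1..n}" "S2 \<subseteq> {1..n}" using S game by (auto simp: simple_game_def)
    have "(\<forall>p<n. ?ok (map (symbol p) [S1, S2, A, B, C])) \<longleftrightarrow>
        S1 \<inter> S2 \<subseteq> A \<inter> B \<and> S1 \<union> S2 \<subseteq> A \<union> B" for A B C
    proof -
      have "(\<forall>p<n. ?ok (map (symbol p) [S1, S2, A, B, C])) \<longleftrightarrow>
          (\<forall>p\<in>{1..n}. (p \<in> S1 \<and> p \<in> S2 \<longrightarrow> p \<in> A \<and> p \<in> B) \<and> (p \<in> S1 \<or> p \<in> S2 \<longrightarrow> p \<in> A \<or> p \<in> B))"
        unfolding all_players[symmetric] by (simp add: symbol_eq_2)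
      thus ?thesis using sub by blast
    qed
    hence ok: "fold (\<lambda>p d. d \<and> ?ok (map (symbol p) [S1, S2, A, B, C])) (rev [0..<n]) True \<longleftrightarrow>
        S1 \<inter> S2 \<subseteq> A \<inter> B \<and> S1 \<union> S2 \<subseteq> A \<union> B" for A B C
      unfolding fold_conj set_rev set_upt atLeast0LessThan Ball_def lessThan_iff by (simp only: simp_thms)
    have "extends_to_2_trade (n, W, Xs, S1, S2) \<longleftrightarrow>
        (\<exists>A\<in>set Xs. \<exists>B\<in>set Xs. S1 \<inter> S2 \<subseteq> A \<inter> B \<and> S1 \<union> S2 \<subseteq> A \<union> B)"
      unfolding Xs by (intro extends_to_2_trade_iff_cover game S fam cofinal)
    \<comment> \<open>The criterion concerns \<open>A\<close> and \<open>B\<close> alone; the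
      quantifier over \<open>C\<close> collapses because \<open>A\<close> witnesses that the list is
      nonempty.\<close>
    moreover have "(\<exists>A\<in>set Xs. \<exists>B\<in>set Xs. \<forall>C\<in>set Xs. P A B) \<longleftrightarrow> (\<exists>A\<in>set Xs. \<exists>B\<in>set Xs. P A B)" for P
      by blast
    ultimately show "extends_to_2_trade (n, W, Xs, S1, S2) \<longleftrightarrow>
        (\<exists>A\<in>set Xs. \<exists>B\<in>set Xs. \<forall>C\<in>set Xs.
          fold (\<lambda>p d. d \<and> ?ok (map (symbol p) [S1, S2, A, B, C])) (rev [0..<n]) True)"
      by (simp only: ok)
  qed
qed

text \<open>Two flags record whether \<open>C\<close> has differed in some column from the candidate
  for \<open>S3\<close> and from that for \<open>S4\<close>; both must be set at the end of the
  block.\<close>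

theorem solvable_from_winning:
  "solvable_in_polynomial_time (trade_instances winning_coalitions) encode_instance extends_to_2_trade"
proof -
  let ?b = "\<lambda>(l :: nat list) i. l ! i = 2"
  let ?P = "\<lambda>l. ?b l 4 \<noteq> in_S3 (?b l 0) (?b l 1) (?b l 2) (?b l 3)"
  let ?Q = "\<lambda>l. ?b l 4 \<noteq> in_S4 (?b l 0) (?b l 1) (?b l 2) (?b l 3)"
  show ?thesis
  proof (rule triple_machine.solvable_by_triple_search[where \<delta> = "\<lambda>d l. (fst d \<or> ?P l, snd d \<or> ?Q l)"
        and init = "(False, False)" and F = "\<lambda>d. fst d \<and> snd d"])
    fix n W Xs S1 S2 assume "(n, W, Xs, S1, S2) \<in> trade_instances winning_coalitions"
    hence game: "simple_game {1..n} W" and Xs: "set Xs = W" and S: "S1 \<in> W" "S2 \<in> W"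
      by (auto simp: trade_instances_def winning_coalitions_def)
    thus "Xs \<noteq> []" by auto
    have W: "W \<subseteq> Pow {1..n}" using game by (auto simp: simple_game_def)
    \<comment> \<open>Outside \<open>{1..n}\<close> all five coalitions are empty and
      \<open>H\<close> is false, so the columns of the players decide equality.\<close>
    have test: "C \<noteq> {p. H (p \<in> S1) (p \<in> S2) (p \<in> A) (p \<in> B)} \<longleftrightarrow>
        (\<exists>p\<in>{0..<n}. (Suc p \<in> C) \<noteq> H (Suc p \<in> S1) (Suc p \<in> S2) (Suc p \<in> A) (Suc p \<in> B))"
      if "A \<in> W" "B \<in> W" "C \<in> W" "\<not> H False False False False" for A B C H
    proof -
      have "C = {p. H (p \<in> S1) (p \<in> S2) (p \<in> A) (p \<in> B)} \<longleftrightarrow>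
          (\<forall>p\<in>{1..n}. p \<in> C \<longleftrightarrow> H (p \<in> S1) (p \<in> S2) (p \<in> A) (p \<in> B))"
      proof -
        have "p \<notin> C \<and> p \<notin> S1 \<and> p \<notin> S2 \<and> p \<notin> A \<and> p \<notin> B" if "p \<notin> {1..n}" for p
          using that \<open>A \<in> W\<close> \<open>B \<in> W\<close> \<open>C \<in> W\<close> S W by blast
        thus ?thesis using that(4) by (auto simp: set_eq_iff)
      qed
      thus ?thesis unfolding all_players[symmetric] by auto
    qed
    have "\<not> in_S3 False False False False" "\<not> in_S4 False False False False"
      by (simp_all add: in_S3_def in_S4_def)
    note tests = test[of _ _ _ in_S3, OF _ _ _ this(1)] test[of _ _ _ in_S4, OF _ _ _ this(2)]
    show "extends_to_2_trade (n, W, Xs, S1, S2) \<longleftrightarrow>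
        (\<exists>A\<in>set Xs. \<exists>B\<in>set Xs. \<forall>C\<in>set Xs.
          fst (fold (\<lambda>p d. (fst d \<or> ?P (map (symbol p) [S1, S2, A, B, C]),
              snd d \<or> ?Q (map (symbol p) [S1, S2, A, B, C]))) (rev [0..<n]) (False, False)) \<and>
          snd (fold (\<lambda>p d. (fst d \<or> ?P (map (symbol p) [S1, S2, A, B, C]),
              snd d \<or> ?Q (map (symbol p) [S1, S2, A, B, C]))) (rev [0..<n]) (False, False)))"
      unfolding extends_to_2_trade_iff_winning[OF game S] Xs fold_disj_pair
      by (intro bex_cong ball_cong refl) (simp add: tests symbol_eq_2)
  qed
qed

theorem proposition2p2:
  fixes X :: "nat set \<Rightarrow> nat set set \<Rightarrow> nat set set"
  assumes "X \<in> {losing_coalitions, maximal_losing_coalitions, winning_coalitions}"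
  shows "solvable_in_polynomial_time (trade_instances X) encode_instance extends_to_2_trade"
proof -
  consider "X = losing_coalitions" | "X = maximal_losing_coalitions" | "X = winning_coalitions"
    using assms by blast
  thus ?thesis
  proof cases
    case 1
    show ?thesis unfolding 1 by (rule solvable_from_losing) (auto simp: losing_coalitions_def)
  next
    case 2
    show ?thesis unfolding 2
    proof (rule solvable_from_losing)
      fix n :: nat and W S assume "S \<in> Pow {1..n} - W"
      thus "\<exists>T\<in>maximal_losing_coalitions {1..n} W. S \<subseteq> T"
        by (intro losing_subset_maximal) (simp_all add: losing_coalitions_def)
    qed (auto simp: maximal_losing_coalitions_def losing_coalitions_def)
  next
    case 3
    show ?thesis unfolding 3 by (rule solvable_from_winning)
  qed
qed

end
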